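(* Let $\alpha\in\mathbb{R}$ and $\beta>-1$. Every $f\in\mathcal{Y}_{\alpha,\beta}$ satisfies $f^\#(z)=O(|z|^{|\alpha|+\beta})$ as $z\to\infty$.
   Context: For $\alpha\in\mathbb{R}$ and $\beta>-1$, the class $\mathcal{Y}_{\alpha,\beta}$ consists of all transcendental meromorphic functions $f$ in $\mathbb{C}$ such that the family $(f_h)_{h\in\mathbb{C},|h|\ge 1}$ of functions $f_h(z)=h^{-\alpha}f(h+h^{-\beta}z)$ (for any, or just one, determination of $h^{-\alpha}$ and $h^{-\beta}$) is normal in $\mathbb{C}$, and no limit function $\lim_{n\to\infty}f_{h_n}$ with $h_n\to\infty$ is constant (the constant $\infty$ is also excluded). Convergence is always locally uniform convergence with respect to the spherical metric. The spherical derivative is $f^\#=|f'|/(1+|f|^2)$ (extended continuously to the poles of $f$). *)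

theory Defs
  imports "HOL-Complex_Analysis.Complex_Analysis" "HOL-Library.Landau_Symbols"
begin

text \<open>The Riemann sphere is represented by \<^typ>\<open>complex option\<close>, where \<^term>\<open>None\<close> is the point
  at infinity. It is viewed as a sphere of diameter 1, so that the metric below has length element
  \<open>|dz| / (1 + |z|\<^sup>2)\<close>, matching the spherical derivative.\<close>

fun chordal_dist :: "complex option \<Rightarrow> complex option \<Rightarrow> real" where
  "chordal_dist None None = 0"
| "chordal_dist None (Some w) = 1 / sqrt (1 + (norm w)\<^sup>2)"
| "chordal_dist (Some z) None = 1 / sqrt (1 + (norm z)\<^sup>2)"
| "chordal_dist (Some z) (Some w) =
     norm (z - w) / (sqrt (1 + (norm z)\<^sup>2) * sqrt (1 + (norm w)\<^sup>2))"

text \<open>On a sphere of diameter 1, a chord of length \<open>c\<close> subtends a great-circle arc of length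
  \<open>arcsin c\<close>; \<open>chordal_dist_le_1\<close> shows that the argument is always in the domain of \<open>arcsin\<close>.\<close>

definition spherical_dist :: "complex option \<Rightarrow> complex option \<Rightarrow> real" where
  "spherical_dist a b = arcsin (chordal_dist a b)"

lemma chordal_dist_nonneg: "chordal_dist a b \<ge> 0"
  by (cases "(a, b)" rule: chordal_dist.cases) auto

lemma chordal_dist_le_1: "chordal_dist a b \<le> 1"
proof (cases "(a, b)" rule: chordal_dist.cases)
  case (4 z w)
  have "(norm (z - w))\<^sup>2 \<le> (norm z + norm w)\<^sup>2"
    by (intro power_mono norm_triangle_ineq4) auto
  also have "\<dots> \<le> (1 + (norm z)\<^sup>2) * (1 + (norm w)\<^sup>2)"
    using zero_le_power2[of "1 - norm z * norm w"] by (simp add: power2_eq_square algebra_simps)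
  finally have "norm (z - w) \<le> sqrt ((1 + (norm z)\<^sup>2) * (1 + (norm w)\<^sup>2))"
    by (rule real_le_rsqrt)
  moreover have "sqrt (1 + (norm z)\<^sup>2) * sqrt (1 + (norm w)\<^sup>2) > 0"
    by (intro mult_pos_pos real_sqrt_gt_zero add_pos_nonneg) auto
  ultimately show ?thesis
    using 4 by (simp add: real_sqrt_mult pos_divide_le_eq)
qed (auto simp: divide_le_eq_1 add_pos_nonneg)

definition sphere_fun :: "(complex \<Rightarrow> complex) \<Rightarrow> complex \<Rightarrow> complex option" where
  "sphere_fun f z = (if is_pole f z then None else Some (f z))"

definition locally_uniform_limit_on ::
    "complex set \<Rightarrow> (nat \<Rightarrow> complex \<Rightarrow> complex option) \<Rightarrow> (complex \<Rightarrow> complex option) \<Rightarrow> bool" where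
  "locally_uniform_limit_on D F g \<longleftrightarrow>
     (\<forall>z\<in>D. \<exists>U. open U \<and> z \<in> U \<and> U \<subseteq> D \<and>
        (\<forall>e>0. \<forall>\<^sub>F n in sequentially. \<forall>w\<in>U. spherical_dist (F n w) (g w) < e))"

text \<open>The limit is not required to be meromorphic or identically infinite: for families of
  meromorphic functions this is automatic.\<close>

definition normal_family_on :: "complex set \<Rightarrow> (complex \<Rightarrow> complex option) set \<Rightarrow> bool" where
  "normal_family_on D \<F> \<longleftrightarrow>
     (\<forall>F. (\<forall>n::nat. F n \<in> \<F>) \<longrightarrow>
        (\<exists>r g. strict_mono (r :: nat \<Rightarrow> nat) \<and> locally_uniform_limit_on D (F \<circ> r) g))"

definition rational_fun :: "(complex \<Rightarrow> complex) \<Rightarrow> bool" where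
  "rational_fun f \<longleftrightarrow> (\<exists>p q. q \<noteq> 0 \<and> (\<forall>z. poly q z \<noteq> 0 \<longrightarrow> f z = poly p z / poly q z))"

text \<open>The second clause of \<open>nicely_meromorphic_on\<close> normalises the values at poles and removable
  singularities, so that each meromorphic function has exactly one representative.\<close>

definition transcendental_meromorphic :: "(complex \<Rightarrow> complex) \<Rightarrow> bool" where
  "transcendental_meromorphic f \<longleftrightarrow> f nicely_meromorphic_on UNIV \<and> \<not> rational_fun f"

text \<open>\<open>pw\<close> selects, for each \<open>h\<close> with \<open>|h| \<ge> 1\<close>, some value of the multivalued power \<open>h\<^sup>a\<close>;
  no continuity in \<open>h\<close> is required.\<close>

definition power_determination :: "real \<Rightarrow> (complex \<Rightarrow> complex) \<Rightarrow> bool" where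
  "power_determination a pw \<longleftrightarrow>
     (\<forall>h. norm h \<ge> 1 \<longrightarrow> (\<exists>L. exp L = h \<and> pw h = exp (of_real a * L)))"

definition rescaled ::
    "(complex \<Rightarrow> complex) \<Rightarrow> (complex \<Rightarrow> complex) \<Rightarrow> (complex \<Rightarrow> complex) \<Rightarrow>
     complex \<Rightarrow> complex \<Rightarrow> complex option" where
  "rescaled f p q h = sphere_fun (\<lambda>z. p h * f (h + q h * z))"

text \<open>Different determinations change \<open>f\<^sub>h(z)\<close> only to \<open>u f\<^sub>h(v z)\<close> with \<open>|u| = |v| = 1\<close>, so asking
  for one determination of \<open>h\<^sup>-\<^sup>\<alpha>\<close> and one of \<open>h\<^sup>-\<^sup>\<beta>\<close> is the same as asking for all of them.\<close>

definition class_Y :: "real \<Rightarrow> real \<Rightarrow> (complex \<Rightarrow> complex) set" where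
  "class_Y \<alpha> \<beta> = {f. transcendental_meromorphic f \<and>
     (\<exists>p q. power_determination (-\<alpha>) p \<and> power_determination (-\<beta>) q \<and>
        normal_family_on UNIV {rescaled f p q h |h. norm h \<ge> 1} \<and>
        (\<forall>h g. (\<forall>n. norm (h n) \<ge> 1) \<and> filterlim h at_infinity sequentially \<and>
           locally_uniform_limit_on UNIV (\<lambda>n. rescaled f p q (h n)) g \<longrightarrow>
           \<not> (\<exists>c. \<forall>z. g z = c)))}"

definition spherical_deriv :: "(complex \<Rightarrow> complex) \<Rightarrow> complex \<Rightarrow> real" where
  "spherical_deriv f z =
     (let s = (\<lambda>w. norm (deriv f w) / (1 + (norm (f w))\<^sup>2))
      in if is_pole f z then Lim (at z) s else s z)"

end

theory Submission
  imports Defs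
begin

text \<open>The bound comes from the elementary direction of Marty's theorem together with a chain-rule
  computation. Normality of the rescaled functions \<open>f\<^sub>h(z) = h\<^sup>-\<^sup>\<alpha> f(h + h\<^sup>-\<^sup>\<beta> z)\<close> makes their
  spherical derivatives at the single point \<open>0\<close> uniformly bounded, say by \<open>M\<close>
  (\<open>normal_family_imp_spherical_deriv_bounded\<close>). On the other hand, if \<open>h\<close> is not a pole, the
  spherical derivative of \<open>f\<close> at \<open>h\<close> is that of \<open>f\<^sub>h\<close> at \<open>0\<close>, multiplied by
  \<open>|h|\<^sup>\<alpha>\<^sup>+\<^sup>\<beta>\<close> and by \<open>(1 + |h|\<^sup>-\<^sup>2\<^sup>\<alpha> |f(h)|\<^sup>2) / (1 + |f(h)|\<^sup>2)\<close>,
  and the last factor is at most \<open>max 1 (|h|\<^sup>-\<^sup>2\<^sup>\<alpha>)\<close> whatever the value of \<open>f(h)\<close>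
  (\<open>spherical_deriv_affine_ge\<close>). As \<open>|h| \<ge> 1\<close>, the product of this maximum with
  \<open>|h|\<^sup>\<alpha>\<^sup>+\<^sup>\<beta>\<close> is \<open>|h|\<close> to the power \<open>|\<alpha>| + \<beta>\<close>, for either sign of \<open>\<alpha>\<close>.

  For the Marty bound, take a sequence in the family along which the spherical derivatives at
  \<open>z\<close> are unbounded, and a subsequence converging uniformly near \<open>z\<close>. Its members are eventually
  close to each other, and one fixed member is continuous, so almost all map one fixed
  disc about \<open>z\<close> into a small chordal disc (\<open>normal_family_imp_spherical_deriv_bounded\<close>).
  A small chordal disc avoids a neighbourhood of \<open>\<infinity>\<close> or of \<open>0\<close>, hence either \<open>f\<close> or \<open>1/f\<close> is
  holomorphic and bounded there, and Cauchy's estimate applies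
  (\<open>spherical_deriv_le_of_small_chordal_image\<close>). Passing to \<open>1/f\<close> is harmless because the
  spherical derivative is invariant under inversion (\<open>spherical_deriv_inverse\<close>).

  Poles need no separate treatment in the rescaling step: the spherical derivative of a meromorphic
  function is at every point the limit of the quotient \<open>|f'| / (1 + |f|\<^sup>2)\<close>
  (\<open>spherical_quotient_tendsto_spherical_deriv\<close>), so an inequality between such quotients in a
  punctured neighbourhood passes to the centre.\<close>

section \<open>The chordal metric\<close>

text \<open>Inverse stereographic projection onto the sphere of diameter 1 in \<open>\<complex> \<times> \<real>\<close>, centred at
  \<open>(0, 1/2)\<close>. The point at infinity is sent to the origin, which is what makes the formulas short.
  The embedding turns the chordal distance into a Euclidean one.\<close>

definition stereographic :: "complex option \<Rightarrow> complex \<times> real" where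
  "stereographic a =
     (case a of None \<Rightarrow> (0, 0) | Some z \<Rightarrow> (z / of_real (1 + (norm z)\<^sup>2), 1 / (1 + (norm z)\<^sup>2)))"

lemma one_plus_norm_sq_pos: "0 < 1 + (norm (z::complex))\<^sup>2"
  by (simp add: add_pos_nonneg)

lemma chordal_dist_eq_dist_stereographic:
  "chordal_dist a b = dist (stereographic a) (stereographic b)"
proof -
  have inf: "dist (0::complex, 0::real) (stereographic (Some z)) = 1 / sqrt (1 + (norm z)\<^sup>2)" for z
  proof -
    define A where "A = 1 + (norm z)\<^sup>2"
    have A: "A > 0" "A \<ge> 1" "(norm z)\<^sup>2 = A - 1" by (auto simp: A_def one_plus_norm_sq_pos)
    have "(dist (0::complex, 0::real) (stereographic (Some z)))\<^sup>2 = (A - 1) / A\<^sup>2 + 1 / A\<^sup>2"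
      using A by (simp add: stereographic_def dist_norm norm_Pair norm_divide power_divide flip: A_def)
    also have "\<dots> = 1 / A"
      using A by (simp add: field_simps power2_eq_square)
    finally have "dist (0::complex, 0::real) (stereographic (Some z)) = sqrt (1 / A)"
      by (metis real_sqrt_unique zero_le_dist)
    thus ?thesis
      by (simp add: real_sqrt_divide A_def)
  qed
  show ?thesis
  proof (cases "(a, b)" rule: chordal_dist.cases)
    case (4 z w)
    define A B where "A = 1 + (norm z)\<^sup>2" and "B = 1 + (norm w)\<^sup>2"
    have A: "A > 0" "B > 0" by (auto simp: A_def B_def one_plus_norm_sq_pos)
    have "(dist (stereographic a) (stereographic b))\<^sup>2 =
            (norm (z / of_real A - w / of_real B))\<^sup>2 + (1 / A - 1 / B)\<^sup>2"
      using 4 by (simp add: stereographic_def dist_norm norm_Pair flip: A_def B_def)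
    also have "z / of_real A - w / of_real B = (of_real B * z - of_real A * w) / of_real (A * B)"
      using A by (simp add: field_simps)
    also have "(norm \<dots>)\<^sup>2 = (norm (of_real B * z - of_real A * w))\<^sup>2 / (A * B)\<^sup>2"
      using A by (simp add: norm_divide power_divide norm_mult)
    also have "1 / A - 1 / B = (B - A) / (A * B)"
      using A by (simp add: field_simps)
    also have "(norm (of_real B * z - of_real A * w))\<^sup>2 / (A * B)\<^sup>2 + ((B - A) / (A * B))\<^sup>2 =
        ((norm (of_real B * z - of_real A * w))\<^sup>2 + (B - A)\<^sup>2) / (A * B)\<^sup>2"
      by (simp add: power_divide add_divide_distrib)
    \<comment> \<open>A polynomial identity, once norms are expressed by real and imaginary parts.\<close>
    also have "(norm (of_real B * z - of_real A * w))\<^sup>2 + (B - A)\<^sup>2 = A * B * (norm (z - w))\<^sup>2"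
      unfolding A_def B_def cmod_power2 by (simp add: power2_eq_square algebra_simps)
    also have "A * B * (norm (z - w))\<^sup>2 / (A * B)\<^sup>2 = (norm (z - w))\<^sup>2 / (A * B)"
      using A by (simp add: power2_eq_square)
    finally have "dist (stereographic a) (stereographic b) = sqrt ((norm (z - w))\<^sup>2 / (A * B))"
      by (metis real_sqrt_unique zero_le_dist)
    thus ?thesis
      using 4 by (simp add: real_sqrt_divide real_sqrt_mult A_def B_def)
  qed (use inf in \<open>auto simp: stereographic_def dist_commute\<close>)
qed

lemma chordal_dist_triangle: "chordal_dist a c \<le> chordal_dist a b + chordal_dist b c"
  by (simp add: chordal_dist_eq_dist_stereographic dist_triangle)

lemma chordal_dist_commute: "chordal_dist a b = chordal_dist b a"
  by (simp add: chordal_dist_eq_dist_stereographic dist_commute)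

text \<open>Convergence is phrased with the arc length, whereas the estimates below use chords; a chord is
  no longer than the arc that it subtends.\<close>

lemma chordal_dist_le_spherical_dist: "chordal_dist a b \<le> spherical_dist a b"
proof -
  have bounds: "-1 \<le> chordal_dist a b" "chordal_dist a b \<le> 1"
    using chordal_dist_nonneg[of a b] chordal_dist_le_1[of a b] by auto
  have "0 \<le> arcsin (chordal_dist a b)"
    using chordal_dist_nonneg[of a b] bounds arcsin_le_arcsin[of 0 "chordal_dist a b"] by simp
  from sin_x_le_x[OF this] show ?thesis
    using bounds by (simp add: spherical_dist_def)
qed

lemma chordal_dist_Some_le_dist: "chordal_dist (Some z) (Some w) \<le> dist z w"
proof -
  have "1 \<le> sqrt (1 + (norm z)\<^sup>2) * sqrt (1 + (norm w)\<^sup>2)"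
    using mult_mono[of 1 "sqrt (1 + (norm z)\<^sup>2)" 1 "sqrt (1 + (norm w)\<^sup>2)"] by simp
  thus ?thesis
    using mult_left_mono[of 1 _ "norm (z - w)"] by (simp add: dist_norm divide_le_eq)
qed

lemma norm_le_if_chordal_dist_infinity_ge:
  assumes "1 / 4 \<le> chordal_dist (Some z) None"
  shows   "norm z \<le> 4"
proof -
  have "sqrt (1 + (norm z)\<^sup>2) \<le> 4"
    using assms one_plus_norm_sq_pos[of z] by (simp add: field_simps)
  moreover have "norm z \<le> sqrt (1 + (norm z)\<^sup>2)"
    by (rule real_le_rsqrt) simp
  ultimately show ?thesis by linarith
qed

lemma norm_ge_if_chordal_dist_zero_ge:
  assumes "1 / 4 \<le> chordal_dist (Some z) (Some 0)"
  shows   "1 / 4 \<le> norm z"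
  using assms chordal_dist_Some_le_dist[of z 0] by (simp del: chordal_dist.simps)


section \<open>The spherical derivative of a meromorphic function\<close>

text \<open>The defining formula of the spherical derivative away from poles. At a pole it has no meaning
  of its own, since \<^term>\<open>deriv\<close> is arbitrary there.\<close>

definition spherical_quotient :: "(complex \<Rightarrow> complex) \<Rightarrow> complex \<Rightarrow> real" where
  "spherical_quotient f w = norm (deriv f w) / (1 + (norm (f w))\<^sup>2)"

lemma spherical_deriv_analytic:
  assumes "f analytic_on {z}"
  shows   "spherical_deriv f z = spherical_quotient f z"
  using analytic_at_imp_no_pole[OF assms]
  by (simp add: spherical_deriv_def spherical_quotient_def)

lemma spherical_deriv_pole:
  assumes "is_pole f z"
  shows   "spherical_deriv f z = Lim (at z) (spherical_quotient f)"
  using assms by (simp add: spherical_deriv_def spherical_quotient_def[abs_def])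

lemma spherical_quotient_tendsto_analytic:
  assumes "f analytic_on {z}"
  shows   "spherical_quotient f \<midarrow>z\<rightarrow> spherical_quotient f z"
proof -
  have "isCont f z" "isCont (deriv f) z"
    using assms by (auto intro: analytic_at_imp_isCont analytic_deriv)
  moreover have "1 + (norm (f z))\<^sup>2 \<noteq> 0"
    using one_plus_norm_sq_pos[of "f z"] by simp
  ultimately show ?thesis
    unfolding spherical_quotient_def[abs_def] isCont_def by (intro tendsto_intros) auto
qed

lemma spherical_quotient_inverse:
  assumes "f field_differentiable at w" "f w \<noteq> 0"
  shows   "spherical_quotient (\<lambda>w. inverse (f w)) w = spherical_quotient f w"
proof -
  have "(norm (f w))\<^sup>2 * (1 + (norm (inverse (f w)))\<^sup>2) = 1 + (norm (f w))\<^sup>2"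
    using assms by (simp add: norm_inverse distrib_left flip: power_mult_distrib)
  moreover have "spherical_quotient (\<lambda>w. inverse (f w)) w =
      norm (deriv f w) / ((norm (f w))\<^sup>2 * (1 + (norm (inverse (f w)))\<^sup>2))"
    using assms by (simp add: spherical_quotient_def norm_divide norm_power)
  ultimately show ?thesis
    by (simp only: spherical_quotient_def)
qed

lemma eventually_analytic_near_point:
  assumes "f meromorphic_on {z}"
  shows   "\<forall>\<^sub>F w in at z. f analytic_on {w}"
  using meromorphic_on_isolated_singularity[OF assms]
  by (simp add: isolated_singularity_at_altdef)

lemma inverse_analytic_at_pole:
  assumes "f nicely_meromorphic_on {z}" "is_pole f z"
  shows   "(\<lambda>w. inverse (f w)) analytic_on {z}"
proof (rule nicely_meromorphic_on_imp_analytic_at)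
  show "(\<lambda>w. inverse (f w)) nicely_meromorphic_on {z}"
    using assms(1) by (rule nicely_meromorphic_on_inverse)
  show "\<not> is_pole (\<lambda>w. inverse (f w)) z"
    using assms(2) pole_is_not_zero by (auto simp: is_pole_inverse_iff)
qed auto

text \<open>At a pole \<open>1/f\<close> is analytic, and near the pole \<open>f\<close> and \<open>1/f\<close> have the same spherical
  quotient. So the limit that defines the spherical derivative at a pole exists.\<close>

lemma spherical_quotient_tendsto_pole:
  assumes "f nicely_meromorphic_on {z}" "is_pole f z"
  shows   "spherical_quotient f \<midarrow>z\<rightarrow> spherical_quotient (\<lambda>w. inverse (f w)) z"
proof -
  have "\<forall>\<^sub>F w in at z. f w \<noteq> 0"
    using assms(2) by (rule non_zero_neighbour_pole)
  moreover have "\<forall>\<^sub>F w in at z. f analytic_on {w}"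
    using assms(1) by (intro eventually_analytic_near_point) (auto simp: nicely_meromorphic_on_def)
  ultimately have
    "\<forall>\<^sub>F w in at z. spherical_quotient (\<lambda>w. inverse (f w)) w = spherical_quotient f w"
    by eventually_elim
      (auto intro!: spherical_quotient_inverse analytic_on_imp_differentiable_at)
  thus ?thesis
    using spherical_quotient_tendsto_analytic[OF inverse_analytic_at_pole[OF assms]]
    by (rule Lim_transform_eventually[rotated])
qed

text \<open>Inversion is a rotation of the sphere. Zeros of \<open>f\<close>, where \<open>1/f\<close> may
  have a pole, are left out: the lemma serves to replace \<open>f\<close> by a bounded \<open>1/f\<close>.\<close>

lemma spherical_deriv_inverse:
  assumes "f nicely_meromorphic_on {z}" "is_pole f z \<or> f z \<noteq> 0"
  shows   "spherical_deriv (\<lambda>w. inverse (f w)) z = spherical_deriv f z"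
proof (cases "is_pole f z")
  case True
  have "Lim (at z) (spherical_quotient f) = spherical_quotient (\<lambda>w. inverse (f w)) z"
    by (intro tendsto_Lim spherical_quotient_tendsto_pole assms(1) True) auto
  thus ?thesis
    using True assms(1)
    by (simp add: spherical_deriv_pole spherical_deriv_analytic inverse_analytic_at_pole)
next
  case False
  hence an: "f analytic_on {z}" and nz: "f z \<noteq> 0"
    using assms by (auto intro: nicely_meromorphic_on_imp_analytic_at)
  hence "(\<lambda>w. inverse (f w)) analytic_on {z}"
    by (intro analytic_intros) auto
  thus ?thesis
    using an nz by (simp add: spherical_deriv_analytic spherical_quotient_inverse
        analytic_on_imp_differentiable_at)
qed

lemma spherical_quotient_tendsto_spherical_deriv:
  assumes "f nicely_meromorphic_on {z}"
  shows   "spherical_quotient f \<midarrow>z\<rightarrow> spherical_deriv f z"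
proof (cases "is_pole f z")
  case True
  have "spherical_deriv f z = spherical_quotient (\<lambda>w. inverse (f w)) z"
    using spherical_deriv_inverse[OF assms] True inverse_analytic_at_pole[OF assms True]
    by (simp add: spherical_deriv_analytic)
  thus ?thesis
    using spherical_quotient_tendsto_pole[OF assms True] by simp
next
  case False
  hence "f analytic_on {z}"
    using assms by (intro nicely_meromorphic_on_imp_analytic_at) auto
  thus ?thesis
    by (simp add: spherical_deriv_analytic spherical_quotient_tendsto_analytic)
qed


section \<open>Normality bounds the spherical derivative at a point\<close>

text \<open>A meromorphic function is continuous as a map to the sphere, also at its poles.\<close>

lemma chordal_dist_sphere_fun_tendsto:
  assumes "f nicely_meromorphic_on {z}"
  shows   "((\<lambda>w. chordal_dist (sphere_fun f w) (sphere_fun f z)) \<longlongrightarrow> 0) (at z)"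
proof (cases "is_pole f z")
  case True
  have "filterlim (\<lambda>w. 1 + (norm (f w))\<^sup>2) at_top (at z)"
    using True unfolding is_pole_def
    by (intro filterlim_tendsto_add_at_top[OF tendsto_const] filterlim_pow_at_top
        filterlim_at_infinity_imp_norm_at_top) auto
  hence "((\<lambda>w. 1 / sqrt (1 + (norm (f w))\<^sup>2)) \<longlongrightarrow> 0) (at z)"
    by (intro tendsto_divide_0[OF tendsto_const] filterlim_at_top_imp_at_infinity
        filterlim_compose[OF sqrt_at_top])
  moreover have "norm (chordal_dist (sphere_fun f w) (sphere_fun f z)) \<le>
      norm (1 / sqrt (1 + (norm (f w))\<^sup>2)) * 1" for w
    using True one_plus_norm_sq_pos[of "f w"] by (simp add: sphere_fun_def)
  ultimately show ?thesis
    by (rule tendsto_0_le[OF _ always_eventually[OF allI]])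
next
  case False
  hence an: "f analytic_on {z}"
    using assms by (intro nicely_meromorphic_on_imp_analytic_at) auto
  have "((\<lambda>w. dist (f w) (f z)) \<longlongrightarrow> 0) (at z)"
    using analytic_at_imp_isCont[OF an] unfolding isCont_def by (rule tendsto_dist_iff[THEN iffD1])
  moreover have "\<forall>\<^sub>F w in at z. f analytic_on {w}"
    using assms by (intro eventually_analytic_near_point) (auto simp: nicely_meromorphic_on_def)
  hence "\<forall>\<^sub>F w in at z. norm (chordal_dist (sphere_fun f w) (sphere_fun f z)) \<le> norm (dist (f w) (f z)) * 1"
  proof eventually_elim
    case (elim w)
    thus ?case
      using False analytic_at_imp_no_pole[OF elim] chordal_dist_Some_le_dist[of "f w" "f z"]
      by (simp add: sphere_fun_def chordal_dist_nonneg del: chordal_dist.simps)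
  qed
  ultimately show ?thesis
    by (rule tendsto_0_le)
qed

text \<open>Cauchy's estimate on the circle of radius \<open>r/2\<close>: halving the radius avoids any assumption on
  the boundary of the disc.\<close>

lemma spherical_deriv_le_of_bounded:
  assumes mero: "f nicely_meromorphic_on ball z r" and "r > 0"
    and no_pole: "\<And>w. w \<in> ball z r \<Longrightarrow> \<not> is_pole f w"
    and bound: "\<And>w. w \<in> ball z r \<Longrightarrow> norm (f w) \<le> B"
  shows "spherical_deriv f z \<le> 2 * B / r"
proof -
  have an: "f analytic_on ball z r"
    using mero no_pole by (intro nicely_meromorphic_without_singularities) auto
  hence hol: "f holomorphic_on ball z r"
    by (rule analytic_imp_holomorphic)
  have "norm ((deriv ^^ 1) f z) \<le> fact 1 * B / (r / 2) ^ 1"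
  proof (rule Cauchy_inequality)
    show "f holomorphic_on ball z (r / 2)"
      by (rule holomorphic_on_subset[OF hol]) (use \<open>r > 0\<close> in auto)
    show "continuous_on (cball z (r / 2)) f"
      by (rule continuous_on_subset[OF holomorphic_on_imp_continuous_on[OF hol]])
        (use \<open>r > 0\<close> in auto)
    show "norm (f w) \<le> B" if "norm (z - w) = r / 2" for w
      using that \<open>r > 0\<close> by (intro bound) (simp add: dist_norm)
  qed (use \<open>r > 0\<close> in auto)
  moreover have "spherical_deriv f z \<le> norm (deriv f z)"
  proof -
    have "f analytic_on {z}"
      using an \<open>r > 0\<close> by (auto intro: analytic_on_subset)
    thus ?thesis
      by (simp add: spherical_deriv_analytic spherical_quotient_def divide_le_eq
          mult_le_cancel_left1 add_pos_nonneg)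
  qed
  ultimately show ?thesis
    by (simp add: mult.commute)
qed

text \<open>The antipodal points \<open>0\<close> and \<open>\<infinity>\<close> have distance 1, so the centre \<open>a\<close> is at distance at least
  \<open>1/2\<close> from one of them, and the whole image at distance at least \<open>1/4\<close> from it. If that
  point is \<open>\<infinity>\<close>, then \<open>f\<close> is bounded by 4; if it is \<open>0\<close>, then \<open>1/f\<close> is.\<close>

lemma spherical_deriv_le_of_small_chordal_image:
  assumes mero: "f nicely_meromorphic_on ball z r" and "r > 0"
    and near: "\<And>w. w \<in> ball z r \<Longrightarrow> chordal_dist (sphere_fun f w) a \<le> 1 / 4"
  shows "spherical_deriv f z \<le> 8 / r"
proof -
  have "1 \<le> chordal_dist a None + chordal_dist a (Some 0)"
    using chordal_dist_triangle[of None "Some 0" a] by (simp add: chordal_dist_commute)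
  then consider "1 / 2 \<le> chordal_dist a None" | "1 / 2 \<le> chordal_dist a (Some 0)"
    by linarith
  thus ?thesis
  proof cases
    case 1
    have far: "1 / 4 \<le> chordal_dist (sphere_fun f w) None" if "w \<in> ball z r" for w
      using 1 near[OF that] chordal_dist_triangle[of a None "sphere_fun f w"]
        chordal_dist_commute[of a "sphere_fun f w"] by linarith
    have no_pole: "\<not> is_pole f w" if "w \<in> ball z r" for w
      using far[OF that] by (auto simp: sphere_fun_def)
    have "norm (f w) \<le> 4" if "w \<in> ball z r" for w
      using far[OF that] no_pole[OF that] norm_le_if_chordal_dist_infinity_ge
      by (simp add: sphere_fun_def del: chordal_dist.simps)
    thus ?thesis
      using spherical_deriv_le_of_bounded[OF mero \<open>r > 0\<close> no_pole, of 4] by simp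
  next
    case 2
    let ?g = "\<lambda>w. inverse (f w)"
    have far: "1 / 4 \<le> chordal_dist (sphere_fun f w) (Some 0)" if "w \<in> ball z r" for w
      using 2 near[OF that] chordal_dist_triangle[of a "Some 0" "sphere_fun f w"]
        chordal_dist_commute[of a "sphere_fun f w"] by linarith
    have pole_or_large: "is_pole f w \<or> 1 / 4 \<le> norm (f w)" if "w \<in> ball z r" for w
      using far[OF that] norm_ge_if_chordal_dist_zero_ge
      by (auto simp: sphere_fun_def simp del: chordal_dist.simps split: if_splits)
    have mero_at: "f nicely_meromorphic_on {w}" if "w \<in> ball z r" for w
      using that by (intro nicely_meromorphic_on_subset[OF mero]) auto
    have g_mero: "?g nicely_meromorphic_on ball z r"
      using mero by (rule nicely_meromorphic_on_inverse)
    have g_no_pole: "\<not> is_pole ?g w" if "w \<in> ball z r" for w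
    proof
      assume "is_pole ?g w"
      hence zero: "isolated_zero f w"
        by (simp add: is_pole_inverse_iff)
      hence "f w = 0"
        using zero_isolated_zero_nicely_meromorphic[OF _ mero_at[OF that]] by blast
      moreover have "\<not> is_pole f w"
        using zero pole_is_not_zero by blast
      ultimately show False
        using pole_or_large[OF that] by simp
    qed
    have g_bound: "norm (?g w) \<le> 4" if "w \<in> ball z r" for w
    proof (cases "is_pole f w")
      case True
      \<comment> \<open>At its poles, a nicely meromorphic function has the value 0, and \<open>inverse 0 = 0\<close>.\<close>
      thus ?thesis
        using is_pole_zero_at_nicely_mero[OF mero True that] by simp
    next
      case False
      hence "1 / 4 \<le> norm (f w)"
        using pole_or_large[OF that] by simp
      from le_imp_inverse_le[OF this] show ?thesis
        by (simp add: norm_inverse)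
    qed
    have "spherical_deriv ?g z \<le> 2 * 4 / r"
      by (rule spherical_deriv_le_of_bounded[OF g_mero \<open>r > 0\<close> g_no_pole g_bound])
    moreover have "spherical_deriv ?g z = spherical_deriv f z"
      using pole_or_large[of z] \<open>r > 0\<close> by (intro spherical_deriv_inverse mero_at) auto
    ultimately show ?thesis
      by simp
  qed
qed

text \<open>This is one half of Marty's criterion, at a single point. The limit function \<open>g\<close> serves
  only to compare the members of the subsequence with one fixed member \<open>F (r N)\<close>, whose continuity supplies the disc. A point of the
  image is reached from \<open>a\<close> by three steps of length below \<open>1/12\<close>, which adds up to the
  \<open>1/4\<close> required above.\<close>

lemma normal_family_imp_spherical_deriv_bounded:
  assumes normal: "normal_family_on D (sphere_fun ` \<F>)"
    and mero: "\<And>f. f \<in> \<F> \<Longrightarrow> f nicely_meromorphic_on D"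
    and "z \<in> D"
  shows "\<exists>M. \<forall>f\<in>\<F>. spherical_deriv f z \<le> M"
proof (rule ccontr)
  assume "\<not> ?thesis"
  hence "\<forall>n::nat. \<exists>f\<in>\<F>. real n < spherical_deriv f z"
    by (meson not_le)
  then obtain F where F: "\<And>n. F n \<in> \<F>" and large: "\<And>n. real n < spherical_deriv (F n) z"
    by metis
  have "\<forall>n. sphere_fun (F n) \<in> sphere_fun ` \<F>"
    using F by blast
  with normal obtain r :: "nat \<Rightarrow> nat" and g where r: "strict_mono r"
      and lim: "locally_uniform_limit_on D ((\<lambda>n. sphere_fun (F n)) \<circ> r) g"
    unfolding normal_family_on_def by meson
  from lim \<open>z \<in> D\<close> obtain U where U: "open U" "z \<in> U" "U \<subseteq> D"
      and unif: "\<And>e. e > 0 \<Longrightarrow>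
        \<forall>\<^sub>F n in sequentially. \<forall>w\<in>U. spherical_dist (sphere_fun (F (r n)) w) (g w) < e"
    unfolding locally_uniform_limit_on_def by (auto simp: o_def)
  obtain N where "\<forall>n\<ge>N. \<forall>w\<in>U. spherical_dist (sphere_fun (F (r n)) w) (g w) < 1 / 12"
    using unif[of "1 / 12"] by (auto simp: eventually_sequentially)
  hence N: "chordal_dist (sphere_fun (F (r n)) w) (g w) < 1 / 12" if "n \<ge> N" "w \<in> U" for n w
    using that by (blast intro: le_less_trans[OF chordal_dist_le_spherical_dist])
  define a where "a = sphere_fun (F (r N)) z"
  have mero_at: "F n nicely_meromorphic_on A" if "A \<subseteq> D" for n A
    using that by (rule nicely_meromorphic_on_subset[OF mero[OF F]])
  have "\<forall>\<^sub>F w in at z. chordal_dist (sphere_fun (F (r N)) w) a < 1 / 12"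
    unfolding a_def
    by (intro order_tendstoD(2)[OF chordal_dist_sphere_fun_tendsto] mero_at)
      (use \<open>z \<in> D\<close> in auto)
  moreover have "chordal_dist a a < 1 / 12"
    by (simp add: chordal_dist_eq_dist_stereographic)
  ultimately have "\<forall>\<^sub>F w in nhds z. chordal_dist (sphere_fun (F (r N)) w) a < 1 / 12"
    unfolding eventually_nhds_conv_at by (simp add: a_def)
  moreover have "\<forall>\<^sub>F w in nhds z. w \<in> U"
    using U by (intro eventually_nhds_in_open) auto
  ultimately have "\<forall>\<^sub>F w in nhds z. w \<in> U \<and> chordal_dist (sphere_fun (F (r N)) w) a < 1 / 12"
    by eventually_elim auto
  then obtain d where d: "d > 0" "\<And>w. w \<in> ball z d \<Longrightarrow> w \<in> U"
      "\<And>w. w \<in> ball z d \<Longrightarrow> chordal_dist (sphere_fun (F (r N)) w) a < 1 / 12"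
    unfolding eventually_nhds_metric by (auto simp: dist_commute)
  have bounded: "spherical_deriv (F (r n)) z \<le> 8 / d" if "n \<ge> N" for n
  proof (rule spherical_deriv_le_of_small_chordal_image)
    show "F (r n) nicely_meromorphic_on ball z d"
      using d(2) U by (intro mero_at) auto
    show "chordal_dist (sphere_fun (F (r n)) w) a \<le> 1 / 4" if w: "w \<in> ball z d" for w
      using N[OF \<open>n \<ge> N\<close> d(2)[OF w]] N[OF order_refl d(2)[OF w]] d(3)[OF w]
        chordal_dist_triangle[of "sphere_fun (F (r n)) w" a "g w"]
        chordal_dist_triangle[of "g w" a "sphere_fun (F (r N)) w"]
        chordal_dist_commute[of "g w" "sphere_fun (F (r N)) w"]
      by linarith
  qed (rule d(1))
  obtain m where m: "8 / d < real m"
    using reals_Archimedean2 by blast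
  have "real (max N m) \<le> real (r (max N m))"
    using seq_suble[OF r] by simp
  with m bounded[of "max N m"] large[of "r (max N m)"] show False
    by linarith
qed


section \<open>Rescaling\<close>

lemma nicely_meromorphic_on_compose_affine:
  assumes "f nicely_meromorphic_on UNIV" "q \<noteq> 0"
  shows   "(\<lambda>z. f (a + q * z)) nicely_meromorphic_on UNIV"
  unfolding nicely_meromorphic_on_def
proof (intro conjI ballI)
  have "f meromorphic_on UNIV"
    using assms(1) by (simp add: nicely_meromorphic_on_def)
  thus "(\<lambda>z. f (a + q * z)) meromorphic_on UNIV"
    by (rule meromorphic_on_compose) (auto intro!: analytic_intros)
next
  fix z
  have lim: "filterlim (\<lambda>z. a + q * z) (at (a + q * z)) (at z)"
    using assms(2) by (intro filterlim_atI tendsto_intros) (auto simp: eventually_at_filter)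
  have "is_pole f (a + q * z) \<and> f (a + q * z) = 0 \<or> f \<midarrow>a + q * z\<rightarrow> f (a + q * z)"
    using assms(1) by (auto simp: nicely_meromorphic_on_def)
  thus "is_pole (\<lambda>z. f (a + q * z)) z \<and> f (a + q * z) = 0 \<or>
      (\<lambda>z. f (a + q * z)) \<midarrow>z\<rightarrow> f (a + q * z)"
    unfolding is_pole_def using lim by (auto intro: filterlim_compose)
qed

text \<open>The chain rule produces the factor \<open>|p q|\<close>; rescaling the values by \<open>p\<close> increases the
  denominator \<open>1 + |f|\<^sup>2\<close> by a factor of at most \<open>max 1 (|p|\<^sup>2)\<close>.\<close>

lemma spherical_quotient_affine_ge:
  assumes "f analytic_on {a + q * z}"
  shows   "norm p * norm q * spherical_quotient f (a + q * z) \<le>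
             max 1 ((norm p)\<^sup>2) * spherical_quotient (\<lambda>z. p * f (a + q * z)) z"
proof -
  let ?b = "a + q * z" and ?m = "max 1 ((norm p)\<^sup>2)"
  have "((\<lambda>z. p * f (a + q * z)) has_field_derivative p * (deriv f ?b * q)) (at z)"
    using assms by (auto intro!: derivative_eq_intros DERIV_chain2[OF analytic_derivI])
  hence D: "deriv (\<lambda>z. p * f (a + q * z)) z = p * (deriv f ?b * q)"
    by (rule DERIV_imp_deriv)
  have "1 + (norm (p * f ?b))\<^sup>2 \<le> ?m + ?m * (norm (f ?b))\<^sup>2"
    unfolding norm_mult power_mult_distrib by (intro add_mono mult_right_mono) auto
  also have "\<dots> = ?m * (1 + (norm (f ?b))\<^sup>2)"
    by (simp add: distrib_left)
  finally have "1 / (1 + (norm (f ?b))\<^sup>2) \<le> ?m / (1 + (norm (p * f ?b))\<^sup>2)"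
    using one_plus_norm_sq_pos[of "f ?b"] one_plus_norm_sq_pos[of "p * f ?b"]
    by (simp only: divide_le_eq pos_le_divide_eq mult_1 times_divide_eq_left simp_thms if_True)
  from mult_left_mono[OF this, of "norm p * norm q * norm (deriv f ?b)"] show ?thesis
    unfolding spherical_quotient_def D by (simp add: norm_mult mult_ac)
qed

text \<open>Both sides are limits of the corresponding quotients, so that poles are covered by
  taking limits in the previous inequality.\<close>

lemma spherical_deriv_affine_ge:
  assumes mero: "f nicely_meromorphic_on UNIV" and "q \<noteq> 0"
  shows "norm p * norm q * spherical_deriv f a \<le>
           max 1 ((norm p)\<^sup>2) * spherical_deriv (\<lambda>z. p * f (a + q * z)) 0"
proof -
  have lim: "filterlim (\<lambda>z. a + q * z) (at a) (at 0)"
    using \<open>q \<noteq> 0\<close> by (intro filterlim_atI tendsto_eq_intros) (auto simp: eventually_at_filter)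
  have "f nicely_meromorphic_on {a}"
    using mero by (rule nicely_meromorphic_on_subset) auto
  hence "((\<lambda>z. spherical_quotient f (a + q * z)) \<longlongrightarrow> spherical_deriv f a) (at 0)"
    using lim by (intro filterlim_compose[OF spherical_quotient_tendsto_spherical_deriv])
  hence lim1: "((\<lambda>z. norm p * norm q * spherical_quotient f (a + q * z)) \<longlongrightarrow>
      norm p * norm q * spherical_deriv f a) (at 0)"
    by (rule tendsto_mult_left)
  have "(\<lambda>z. p * f (a + q * z)) nicely_meromorphic_on UNIV"
    using assms by (intro nicely_meromorphic_on_cmult_left nicely_meromorphic_on_compose_affine)
  hence "(\<lambda>z. p * f (a + q * z)) nicely_meromorphic_on {0}"
    by (rule nicely_meromorphic_on_subset) auto
  hence lim2: "((\<lambda>z. max 1 ((norm p)\<^sup>2) * spherical_quotient (\<lambda>z. p * f (a + q * z)) z) \<longlongrightarrow>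
      max 1 ((norm p)\<^sup>2) * spherical_deriv (\<lambda>z. p * f (a + q * z)) 0) (at 0)"
    by (intro tendsto_mult_left spherical_quotient_tendsto_spherical_deriv)
  have "f meromorphic_on {a}"
    using \<open>f nicely_meromorphic_on {a}\<close> by (simp add: nicely_meromorphic_on_def)
  hence "\<forall>\<^sub>F z in at 0. f analytic_on {a + q * z}"
    using lim by (intro eventually_compose_filterlim[OF eventually_analytic_near_point])
  hence "\<forall>\<^sub>F z in at 0. norm p * norm q * spherical_quotient f (a + q * z) \<le>
      max 1 ((norm p)\<^sup>2) * spherical_quotient (\<lambda>z. p * f (a + q * z)) z"
    by eventually_elim (rule spherical_quotient_affine_ge)
  with lim2 lim1 show ?thesis
    by (rule tendsto_le[OF at_neq_bot])
qed

lemma norm_power_determination: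
  assumes "power_determination a pw" "norm h \<ge> 1"
  shows   "norm (pw h) = norm h powr a"
proof -
  obtain L where L: "exp L = h" "pw h = exp (of_real a * L)"
    using assms unfolding power_determination_def by blast
  have "norm h = exp (Re L)"
    using L(1) by auto
  thus ?thesis
    using L(2) by (simp add: powr_def)
qed

theorem theorem1:
  fixes \<alpha> \<beta> :: real and f :: "complex \<Rightarrow> complex"
  assumes "\<beta> > -1"
    and "f \<in> class_Y \<alpha> \<beta>"
  shows "(\<lambda>z. spherical_deriv f z) \<in> O[at_infinity](\<lambda>z. norm z powr (\<bar>\<alpha>\<bar> + \<beta>))"
proof -
  from assms(2) obtain p q where mero: "f nicely_meromorphic_on UNIV"
      and p: "power_determination (-\<alpha>) p" and q: "power_determination (-\<beta>) q"
      and normal: "normal_family_on UNIV {rescaled f p q h |h. norm h \<ge> 1}"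
    by (auto simp: class_Y_def transcendental_meromorphic_def)
  define F where "F h = (\<lambda>z. p h * f (h + q h * z))" for h
  have norm_pq: "norm (p h) = norm h powr -\<alpha>" "norm (q h) = norm h powr -\<beta>" if "norm h \<ge> 1" for h
    using that p q by (simp_all add: norm_power_determination)
  have q_nz: "q h \<noteq> 0" if "norm h \<ge> 1" for h
    using norm_pq(2)[OF that] that by auto
  have "{rescaled f p q h |h. norm h \<ge> 1} = sphere_fun ` F ` {h. norm h \<ge> 1}"
    by (auto simp: rescaled_def F_def)
  with normal have "normal_family_on UNIV (sphere_fun ` F ` {h. norm h \<ge> 1})"
    by simp
  moreover have "g nicely_meromorphic_on UNIV" if "g \<in> F ` {h. norm h \<ge> 1}" for g
    using that q_nz mero unfolding F_def
    by (auto intro!: nicely_meromorphic_on_cmult_left nicely_meromorphic_on_compose_affine)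
  ultimately obtain M where M: "\<And>h. norm h \<ge> 1 \<Longrightarrow> spherical_deriv (F h) 0 \<le> M"
    using normal_family_imp_spherical_deriv_bounded[of UNIV _ 0] by blast
  have bound: "spherical_deriv f h \<le> M * norm h powr (\<bar>\<alpha>\<bar> + \<beta>)" if h: "norm h \<ge> 1" for h
  proof -
    define t where "t = norm h"
    have t: "t \<ge> 1" using h by (simp add: t_def)
    have sq: "(t powr -\<alpha>)\<^sup>2 = t powr (-2 * \<alpha>)"
      using t by (simp add: power2_eq_square flip: powr_add)
    \<comment> \<open>This exponent, plus \<open>\<alpha> + \<beta>\<close> from dividing by \<open>|p h| |q h|\<close>, gives \<open>|\<alpha>| + \<beta>\<close>.\<close>
    have "max 1 ((t powr -\<alpha>)\<^sup>2) = t powr (\<bar>\<alpha>\<bar> - \<alpha>)"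
    proof (cases "\<alpha> \<ge> 0")
      case True
      thus ?thesis
        using t powr_mono[of "-2 * \<alpha>" 0 t] unfolding sq by simp
    next
      case False
      thus ?thesis
        using t powr_mono[of 0 "-2 * \<alpha>" t] unfolding sq by simp
    qed
    hence "t powr -\<alpha> * t powr -\<beta> * spherical_deriv f h \<le>
        t powr (\<bar>\<alpha>\<bar> - \<alpha>) * spherical_deriv (F h) 0"
      using spherical_deriv_affine_ge[OF mero q_nz[OF h], of "p h" h] norm_pq[OF h]
      by (simp add: F_def t_def)
    also have "\<dots> \<le> t powr (\<bar>\<alpha>\<bar> - \<alpha>) * M"
      by (intro mult_left_mono M h) auto
    finally have "t powr (\<alpha> + \<beta>) * (t powr -\<alpha> * t powr -\<beta> * spherical_deriv f h) \<le>
        t powr (\<alpha> + \<beta>) * (t powr (\<bar>\<alpha>\<bar> - \<alpha>) * M)"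
      by (rule mult_left_mono) auto
    moreover have "t powr (\<alpha> + \<beta>) * (t powr -\<alpha> * t powr -\<beta>) = 1"
      using t by (simp flip: powr_add)
    moreover have "t powr (\<alpha> + \<beta>) * t powr (\<bar>\<alpha>\<bar> - \<alpha>) = t powr (\<bar>\<alpha>\<bar> + \<beta>)"
      by (simp add: add.commute flip: powr_add)
    ultimately have "spherical_deriv f h \<le> t powr (\<bar>\<alpha>\<bar> + \<beta>) * M"
      unfolding mult.assoc[symmetric] by simp
    thus ?thesis
      by (simp add: t_def mult.commute)
  qed
  have nonneg: "spherical_deriv f h \<ge> 0" for h
  proof (rule tendsto_lowerbound)
    show "spherical_quotient f \<midarrow>h\<rightarrow> spherical_deriv f h"
      using nicely_meromorphic_on_subset[OF mero]
      by (intro spherical_quotient_tendsto_spherical_deriv) auto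
  qed (auto simp: spherical_quotient_def)
  show ?thesis
  proof (rule bigoI)
    show "\<forall>\<^sub>F h in at_infinity. norm (spherical_deriv f h) \<le> M * norm (norm h powr (\<bar>\<alpha>\<bar> + \<beta>))"
      unfolding eventually_at_infinity using bound nonneg by (intro exI[of _ 1]) auto
  qed
qed

end
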